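(* Let $R$ be a transit function on a non-empty finite set $V$ satisfying Axioms (b1'), (b2'), (J2), (J4), (J4'), (TW1') and (TWA). Then $T=R$ on $G_R$, i.e. $R(u,v)=T(u,v)$ for all $u,v\in V$, where $T$ is the toll walk transit function of the underlying graph $G_R$.
   Context: A transit function on a set $V$ is a map $R:V\times V\to 2^V$ such that for all $u,v\in V$: $u\in R(u,v)$, $R(u,v)=R(v,u)$ and $R(u,u)=\{u\}$. The underlying graph $G_R$ has vertex set $V$, and distinct $u,v$ are adjacent iff $R(u,v)=\{u,v\}$. In a finite simple graph $G$, a walk $W=w_1w_2\cdots w_k$ ($k\ge 2$) is a toll walk if $w_1\neq w_k$, $w_2$ is the only neighbor of $w_1$ among the vertices of $W$, and $w_{k-1}$ is the only neighbor of $w_k$ among the vertices of $W$. The toll walk transit function $T$ of $G$ is given by $T(u,u)=\{u\}$ and, for $u\ne v$, $T(u,v)$ is the set of all vertices lying on some toll walk from $u$ to $v$. The axioms (all quantified over elements of $V$): (b1') If $x\in R(u,v)$, $v\neq x$ and $R(v,x)\neq\{v,x\}$, then $v\notin R(u,x)$. (b2') If $x\in R(u,v)$ and $R(u,x)\neq\{u,x\}$, then $R(x,v)\subseteq R(u,v)$. (J2) If $R(u,x)=\{u,x\}$, $R(x,v)=\{x,v\}$, $u\neq v$ and $R(u,v)\neq\{u,v\}$, then $x\in R(u,v)$. (J4) If $x\in R(u,y)$, $y\in R(x,v)$, $x\neq y$, $R(u,x)=\{u,x\}$, $R(y,v)=\{y,v\}$ and $R(u,v)\neq\{u,v\}$,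 then $x\in R(u,v)$. (J4') If $x\in R(u,y)$, $y\in R(x,v)$, $R(u,x)\neq\{u,x\}$, $R(y,v)\neq\{y,v\}$, $R(x,y)\neq\{x,y\}$ and $R(u,v)\neq\{u,v\}$, then $x\in R(u,v)$. (TW1') If $x,y\in R(u,v)$, $x\neq u$, $y\neq v$, $R(x,v)\neq\{x,v\}$, $R(u,y)\neq\{u,y\}$, $R(x,z)=\{x,z\}$, $R(z,w)=\{z,w\}$, $R(w,y)=\{w,y\}$ and $R(u,w)\neq\{u,w\}$, then $z\in R(u,v)$. (TWA) If $u,v,x$ are pairwise distinct and $x\in R(u,v)$, then there exists $x_1\in R(x,v)\cap R(u,v)$ with $x_1\neq x$, $R(x,x_1)=\{x,x_1\}$, $R(u,x_1)\neq\{u,x_1\}$ and $R(x_1,v)\subsetneq R(x,v)$. *)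

theory Defs
  imports "Graph_Theory.Graph_Theory"
begin

text \<open>Only the values of a transit function on its carrier matter; values at arguments
  outside the carrier are unconstrained.\<close>

definition transit_function :: "'a set \<Rightarrow> ('a \<Rightarrow> 'a \<Rightarrow> 'a set) \<Rightarrow> bool" where
  "transit_function V R \<longleftrightarrow>
     (\<forall>u\<in>V. \<forall>v\<in>V. R u v \<subseteq> V \<and> u \<in> R u v \<and> R u v = R v u) \<and> (\<forall>u\<in>V. R u u = {u})"

text \<open>A finite simple graph is modelled as a \<open>pair_graph\<close>: a finite loopfree symmetric digraph
  without parallel arcs.\<close>

definition underlying_graph :: "'a set \<Rightarrow> ('a \<Rightarrow> 'a \<Rightarrow> 'a set) \<Rightarrow> 'a pair_pre_digraph" where
  "underlying_graph V R =
     \<lparr> pverts = V, parcs = {(u, v). u \<in> V \<and> v \<in> V \<and> u \<noteq> v \<and> R u v = {u, v}} \<rparr>"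

lemma pair_graph_underlying_graph:
  assumes "finite V" and "transit_function V R"
  shows "pair_graph (underlying_graph V R)"
proof -
  have "finite (parcs (underlying_graph V R))"
    by (rule finite_subset[of _ "V \<times> V"]) (use assms(1) in \<open>auto simp: underlying_graph_def\<close>)
  moreover have "sym (parcs (underlying_graph V R))"
    using assms(2) unfolding sym_def underlying_graph_def transit_function_def
    by (auto simp: insert_commute)
  ultimately show ?thesis
    using assms(1) by unfold_locales (auto simp: underlying_graph_def symmetric_def)
qed

text \<open>A walk \<open>w\<^sub>1 \<dots> w\<^sub>k\<close> is the list \<open>W\<close> with \<open>W ! 0 = w\<^sub>1\<close> and \<open>W ! (k - 1) = w\<^sub>k\<close>. As usual for toll
  walks, the uniqueness of the neighbour is about positions of the walk: \<open>w\<^sub>1\<close> is adjacent to \<open>w\<^sub>i\<close>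
  iff \<open>i = 2\<close>, and \<open>w\<^sub>k\<close> is adjacent to \<open>w\<^sub>i\<close> iff \<open>i = k - 1\<close>. In particular \<open>w\<^sub>2\<close> and \<open>w\<^bsub>k-1\<^esub>\<close> are not
  revisited (in a star with centre \<open>c\<close> and leaves \<open>u, v, x\<close>, the walk \<open>u c x c v\<close> is not a toll
  walk), while other vertices may repeat.\<close>

definition toll_walk :: "'a pair_pre_digraph \<Rightarrow> 'a vwalk \<Rightarrow> bool" where
  "toll_walk G W \<longleftrightarrow>
     vwalk W (with_proj G) \<and> length W \<ge> 2 \<and> hd W \<noteq> last W \<and>
     (\<forall>i < length W. (hd W, W ! i) \<in> parcs G \<longleftrightarrow> i = 1) \<and>
     (\<forall>i < length W. (last W, W ! i) \<in> parcs G \<longleftrightarrow> i = length W - 2)"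

definition toll_transit :: "'a pair_pre_digraph \<Rightarrow> 'a \<Rightarrow> 'a \<Rightarrow> 'a set" where
  "toll_transit G u v =
     (if u = v then {u} else {x. \<exists>W. toll_walk G W \<and> hd W = u \<and> last W = v \<and> x \<in> set W})"

definition axiom_b1' :: "'a set \<Rightarrow> ('a \<Rightarrow> 'a \<Rightarrow> 'a set) \<Rightarrow> bool" where
  "axiom_b1' V R \<longleftrightarrow> (\<forall>u\<in>V. \<forall>v\<in>V. \<forall>x\<in>V.
     x \<in> R u v \<and> v \<noteq> x \<and> R v x \<noteq> {v, x} \<longrightarrow> v \<notin> R u x)"

definition axiom_b2' :: "'a set \<Rightarrow> ('a \<Rightarrow> 'a \<Rightarrow> 'a set) \<Rightarrow> bool" where
  "axiom_b2' V R \<longleftrightarrow> (\<forall>u\<in>V. \<forall>v\<in>V. \<forall>x\<in>V.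
     x \<in> R u v \<and> R u x \<noteq> {u, x} \<longrightarrow> R x v \<subseteq> R u v)"

definition axiom_J2 :: "'a set \<Rightarrow> ('a \<Rightarrow> 'a \<Rightarrow> 'a set) \<Rightarrow> bool" where
  "axiom_J2 V R \<longleftrightarrow> (\<forall>u\<in>V. \<forall>v\<in>V. \<forall>x\<in>V.
     R u x = {u, x} \<and> R x v = {x, v} \<and> u \<noteq> v \<and> R u v \<noteq> {u, v} \<longrightarrow> x \<in> R u v)"

definition axiom_J4 :: "'a set \<Rightarrow> ('a \<Rightarrow> 'a \<Rightarrow> 'a set) \<Rightarrow> bool" where
  "axiom_J4 V R \<longleftrightarrow> (\<forall>u\<in>V. \<forall>v\<in>V. \<forall>x\<in>V. \<forall>y\<in>V.
     x \<in> R u y \<and> y \<in> R x v \<and> x \<noteq> y \<and> R u x = {u, x} \<and> R y v = {y, v} \<and> R u v \<noteq> {u, v}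
       \<longrightarrow> x \<in> R u v)"

definition axiom_J4' :: "'a set \<Rightarrow> ('a \<Rightarrow> 'a \<Rightarrow> 'a set) \<Rightarrow> bool" where
  "axiom_J4' V R \<longleftrightarrow> (\<forall>u\<in>V. \<forall>v\<in>V. \<forall>x\<in>V. \<forall>y\<in>V.
     x \<in> R u y \<and> y \<in> R x v \<and> R u x \<noteq> {u, x} \<and> R y v \<noteq> {y, v} \<and> R x y \<noteq> {x, y} \<and> R u v \<noteq> {u, v}
       \<longrightarrow> x \<in> R u v)"

definition axiom_TW1' :: "'a set \<Rightarrow> ('a \<Rightarrow> 'a \<Rightarrow> 'a set) \<Rightarrow> bool" where
  "axiom_TW1' V R \<longleftrightarrow> (\<forall>u\<in>V. \<forall>v\<in>V. \<forall>x\<in>V. \<forall>y\<in>V. \<forall>z\<in>V. \<forall>w\<in>V.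
     x \<in> R u v \<and> y \<in> R u v \<and> x \<noteq> u \<and> y \<noteq> v \<and> R x v \<noteq> {x, v} \<and> R u y \<noteq> {u, y} \<and>
     R x z = {x, z} \<and> R z w = {z, w} \<and> R w y = {w, y} \<and> R u w \<noteq> {u, w}
       \<longrightarrow> z \<in> R u v)"

definition axiom_TWA :: "'a set \<Rightarrow> ('a \<Rightarrow> 'a \<Rightarrow> 'a set) \<Rightarrow> bool" where
  "axiom_TWA V R \<longleftrightarrow> (\<forall>u\<in>V. \<forall>v\<in>V. \<forall>x\<in>V.
     u \<noteq> v \<and> u \<noteq> x \<and> v \<noteq> x \<and> x \<in> R u v
       \<longrightarrow> (\<exists>x1 \<in> R x v \<inter> R u v.
             x1 \<noteq> x \<and> R x x1 = {x, x1} \<and> R u x1 \<noteq> {u, x1} \<and> R x1 v \<subset> R x v))"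

end

theory Submission
  imports Defs
begin

text \<open>One inclusion comes from iterating (TWA) from \<open>x \<in> R u v\<close> towards \<open>v\<close> and, with the roles
  exchanged, towards \<open>u\<close>: the sets \<open>R x v\<close> shrink, so both iterations end, and gluing the two walks
  at \<open>x\<close> gives a toll walk.

  For the other inclusion let \<open>f 0, \<dots>, f n\<close> be a toll walk from \<open>u\<close> to \<open>v\<close> with \<open>n \<ge> 4\<close>. By (TW1'),
  every neighbour of a vertex of \<open>R u v\<close> that is far from both \<open>u\<close> and \<open>v\<close> lies in \<open>R u v\<close>, so it
  suffices to find one \<open>i\<close> with \<open>2 \<le> i \<le> n - 2\<close> and \<open>f i \<in> R u v\<close>. A chord between
  positions \<open>i + 1 < j\<close> of \<open>{1..n-1}\<close> other than the pair \<open>(1, n - 1)\<close> shortens the walk, and induction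
  on \<open>n\<close> applies. Without such a chord (J4) and (TW1') settle \<open>n \<le> 5\<close>, and for \<open>n \<ge> 6\<close> the initial
  segment up to \<open>f (n - 2)\<close> and the final segment from \<open>f 2\<close> are themselves toll walks, so
  (J4') yields \<open>f 2 \<in> R u v\<close>.\<close>

section \<open>Toll walks as sequences indexed by position\<close>

text \<open>A walk with \<open>n\<close> edges is a function on the positions \<open>0..n\<close>,
  so that reversing, truncating and shortcutting become index arithmetic. Values beyond
  \<open>n\<close> do not matter.\<close>

definition toll_seq :: "'a pair_pre_digraph \<Rightarrow> (nat \<Rightarrow> 'a) \<Rightarrow> nat \<Rightarrow> bool" where
  "toll_seq G f n \<longleftrightarrow>
     n \<ge> 1 \<and> f 0 \<noteq> f n \<and> (\<forall>i\<le>n. f i \<in> pverts G) \<and> (\<forall>i<n. (f i, f (Suc i)) \<in> parcs G) \<and>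
     (\<forall>i\<le>n. (f 0, f i) \<in> parcs G \<longleftrightarrow> i = 1) \<and>
     (\<forall>i\<le>n. (f n, f i) \<in> parcs G \<longleftrightarrow> i = n - 1)"

lemma toll_seq_cong:
  assumes "\<And>i. i \<le> n \<Longrightarrow> f i = g i"
  shows "toll_seq G f n \<longleftrightarrow> toll_seq G g n"
  unfolding toll_seq_def using assms by simp

lemma set_vwalk_arcs_nth:
  "set (vwalk_arcs p) = {(p ! i, p ! Suc i) | i. Suc i < length p}"
proof (induction p rule: vwalk_arcs.induct)
  case (3 x y xs)
  have "{(((x # y # xs) ! i), (x # y # xs) ! Suc i) | i. Suc i < length (x # y # xs)}
    = insert (x, y) {((y # xs) ! i, (y # xs) ! Suc i) | i. Suc i < length (y # xs)}" (is "?L = ?R")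
  proof (intro equalityI subsetI)
    fix e assume "e \<in> ?L"
    then obtain i where "e = ((x # y # xs) ! i, (x # y # xs) ! Suc i)" "Suc i < length (x # y # xs)"
      by blast
    then show "e \<in> ?R" by (cases i) auto
  next
    fix e assume "e \<in> ?R"
    then consider "e = (x, y)"
      | i where "e = ((y # xs) ! i, (y # xs) ! Suc i)" "Suc i < length (y # xs)"
      by blast
    then show "e \<in> ?L"
    proof cases
      case 1
      then show ?thesis by (auto intro: exI[of _ 0])
    next
      case (2 i)
      then show ?thesis by (auto intro!: exI[of _ "Suc i"])
    qed
  qed
  with 3 show ?case by simp
qed auto

lemma toll_walk_iff_toll_seq:
  "toll_walk G W \<longleftrightarrow> length W \<ge> 2 \<and> toll_seq G ((!) W) (length W - 1)"
proof (cases "length W \<ge> 2")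
  case True
  define n where "n = length W - 1"
  have W: "W \<noteq> []" "length W = Suc n" "n \<ge> 1" "length W - 2 = n - 1"
    using True unfolding n_def by auto
  have hl: "hd W = W ! 0" "last W = W ! n"
    using W by (simp_all add: hd_conv_nth last_conv_nth)
  have "set W \<subseteq> pverts G \<longleftrightarrow> (\<forall>i\<le>n. W ! i \<in> pverts G)"
    using W by (auto simp: subset_iff in_set_conv_nth less_Suc_eq_le)
  moreover have "set (vwalk_arcs W) \<subseteq> parcs G \<longleftrightarrow> (\<forall>i<n. (W ! i, W ! Suc i) \<in> parcs G)"
    using W by (auto simp: set_vwalk_arcs_nth)
  moreover have "arcs_ends (with_proj G) = parcs G"
    by (auto simp: arcs_ends_def arc_to_ends_def)
  ultimately show ?thesis
    using W unfolding toll_walk_def toll_seq_def vwalk_def hl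
    by (auto simp: less_Suc_eq_le)
qed (auto simp: toll_walk_def)

lemma toll_transit_eq_toll_seq:
  assumes "u \<noteq> v"
  shows "toll_transit G u v = {f i | f i n. toll_seq G f n \<and> f 0 = u \<and> f n = v \<and> i \<le> n}"
proof (intro equalityI subsetI)
  fix x assume "x \<in> toll_transit G u v"
  then obtain W where W: "toll_walk G W" "hd W = u" "last W = v" "x \<in> set W"
    using assms by (auto simp: toll_transit_def)
  then have l: "length W \<ge> 2" "toll_seq G ((!) W) (length W - 1)"
    by (auto simp: toll_walk_iff_toll_seq)
  then have "W \<noteq> []" by auto
  then have "W ! 0 = u" "W ! (length W - 1) = v"
    using W by (simp_all add: hd_conv_nth last_conv_nth)
  moreover obtain i where "i < length W" "x = W ! i"
    using W(4) by (auto simp: in_set_conv_nth)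
  ultimately show "x \<in> {f i | f i n. toll_seq G f n \<and> f 0 = u \<and> f n = v \<and> i \<le> n}"
    using l by (intro CollectI exI[of _ "(!) W"] exI[of _ i] exI[of _ "length W - 1"]) auto
next
  fix x assume "x \<in> {f i | f i n. toll_seq G f n \<and> f 0 = u \<and> f n = v \<and> i \<le> n}"
  then obtain f i n where f: "toll_seq G f n" "f 0 = u" "f n = v" "i \<le> n" "x = f i"
    by blast
  define W where "W = map f [0..<Suc n]"
  have nth: "W ! j = f j" if "j \<le> n" for j
    using that by (simp add: W_def del: upt_Suc)
  have len: "length W = Suc n" "W \<noteq> []"
    by (simp_all add: W_def del: upt_Suc)
  have "n \<ge> 1" using f(1) by (simp add: toll_seq_def)
  moreover have "toll_seq G ((!) W) n"
    using f(1) by (auto simp: toll_seq_def nth)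
  moreover have "hd W = u" "last W = v"
    using f len by (simp_all add: hd_conv_nth last_conv_nth nth)
  moreover have "x \<in> set W"
    using f by (auto simp: W_def simp del: upt_Suc)
  ultimately show "x \<in> toll_transit G u v"
    using assms len unfolding toll_transit_def toll_walk_iff_toll_seq
    by (auto intro!: exI[of _ W])
qed

section \<open>The underlying graph of a transit function\<close>

locale transit =
  fixes V :: "'a set" and R :: "'a \<Rightarrow> 'a \<Rightarrow> 'a set"
  assumes finite_V: "finite V"
    and transit: "transit_function V R"
begin

abbreviation "G \<equiv> underlying_graph V R"

abbreviation adj :: "'a \<Rightarrow> 'a \<Rightarrow> bool" where
  "adj x y \<equiv> (x, y) \<in> parcs G"

lemma adj_iff: "adj x y \<longleftrightarrow> x \<in> V \<and> y \<in> V \<and> x \<noteq> y \<and> R x y = {x, y}"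
  by (auto simp: underlying_graph_def)

lemma pverts_G [simp]: "pverts G = V"
  by (simp add: underlying_graph_def)

lemma R_subset: "u \<in> V \<Longrightarrow> v \<in> V \<Longrightarrow> R u v \<subseteq> V"
  and R_sym: "u \<in> V \<Longrightarrow> v \<in> V \<Longrightarrow> R u v = R v u"
  and R_refl: "u \<in> V \<Longrightarrow> R u u = {u}"
  and R_left: "u \<in> V \<Longrightarrow> v \<in> V \<Longrightarrow> u \<in> R u v"
  and R_right: "u \<in> V \<Longrightarrow> v \<in> V \<Longrightarrow> v \<in> R u v"
  using transit unfolding transit_function_def by blast+

lemma adj_sym: "adj x y \<longleftrightarrow> adj y x"
  using R_sym[of x y] by (auto simp: adj_iff insert_commute)

lemma not_adj_self: "\<not> adj x x"
  by (simp add: adj_iff)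

text \<open>In the axioms \<open>R x y = {x, y}\<close> also covers \<open>x = y\<close>.\<close>

lemma R_eq_pair_iff: "x \<in> V \<Longrightarrow> y \<in> V \<Longrightarrow> R x y = {x, y} \<longleftrightarrow> x = y \<or> adj x y"
  by (auto simp: adj_iff R_refl)

section \<open>Reversing, truncating and shortcutting toll walks\<close>

lemma toll_seq_rev:
  assumes "toll_seq G f n"
  shows "toll_seq G (\<lambda>i. f (n - i)) n"
proof -
  note f = assms[unfolded toll_seq_def]
  have "adj (f (n - i)) (f (n - Suc i))" if "i < n" for i
  proof -
    have "n - Suc i < n" "Suc (n - Suc i) = n - i" using that by auto
    then show ?thesis using f adj_sym by metis
  qed
  moreover have "adj (f n) (f (n - i)) \<longleftrightarrow> i = 1" if "i \<le> n" for i
  proof -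
    have "adj (f n) (f (n - i)) \<longleftrightarrow> n - i = n - 1" using f diff_le_self by blast
    then show ?thesis using f that by auto
  qed
  moreover have "adj (f 0) (f (n - i)) \<longleftrightarrow> i = n - 1" if "i \<le> n" for i
  proof -
    have "adj (f 0) (f (n - i)) \<longleftrightarrow> n - i = 1" using f diff_le_self by blast
    then show ?thesis using f that by auto
  qed
  ultimately show ?thesis
    using f unfolding toll_seq_def by auto
qed

text \<open>A return to \<open>f 0\<close> at a position \<open>i < n\<close> would make
  \<open>f (Suc i)\<close> a neighbour of \<open>f 0\<close> at a position other than 1. The case
  \<open>i = n\<close> is part of the definition.\<close>

lemma toll_seq_first_neq:
  assumes "toll_seq G f n" and "0 < i" and "i \<le> n"
  shows "f i \<noteq> f 0"
proof (cases "i = n")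
  case False
  then have "adj (f i) (f (Suc i))" "Suc i \<le> n" "Suc i \<noteq> 1"
    using assms by (auto simp: toll_seq_def)
  then show ?thesis using assms(1) by (metis toll_seq_def)
qed (use assms in \<open>auto simp: toll_seq_def\<close>)

lemma toll_seq_last_neq:
  assumes "toll_seq G f n" and "i < n"
  shows "f i \<noteq> f n"
  using toll_seq_first_neq[OF toll_seq_rev[OF assms(1)], of "n - i"] assms(2) by simp

text \<open>The conditions at \<open>f 0\<close> are inherited, and \<open>f 0\<close> is not
  adjacent to \<open>f m\<close> because \<open>m \<ge> 2\<close>. So only chords from inner
  positions to the new end \<open>f m\<close> have to be excluded.\<close>

lemma toll_seq_take:
  assumes f: "toll_seq G f n" and m: "2 \<le> m" "m < n"
    and no: "\<And>i. 1 \<le> i \<Longrightarrow> i + 1 < m \<Longrightarrow> \<not> adj (f i) (f m)"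
  shows "toll_seq G f m"
proof -
  have "adj (f m) (f i) \<longleftrightarrow> i = m - 1" if "i \<le> m" for i
  proof -
    have "i = 0 \<or> 1 \<le> i \<and> i + 1 < m \<or> i = m - 1 \<or> i = m"
      using that by arith
    then consider "i = 0" | "1 \<le> i" "i + 1 < m" | "i = m - 1" | "i = m"
      by blast
    then show ?thesis
    proof cases
      case 1
      moreover have "\<not> adj (f 0) (f m)" using f m by (auto simp: toll_seq_def)
      ultimately show ?thesis using m adj_sym by fastforce
    next
      case 2
      then show ?thesis using no adj_sym by fastforce
    next
      case 3
      then have "Suc i = m" "i < n" using m by auto
      then have "adj (f i) (f m)" using f unfolding toll_seq_def by blast
      then show ?thesis using 3 adj_sym by blast
    next
      case 4
      then show ?thesis using m not_adj_self by auto
    qed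
  qed
  moreover have "f 0 \<noteq> f m" using toll_seq_first_neq[OF f, of m] m by auto
  ultimately show ?thesis using f m unfolding toll_seq_def by auto
qed

text \<open>Mirror image of \<open>toll_seq_take\<close>: reverse, truncate, reverse back.\<close>

lemma toll_seq_drop:
  assumes f: "toll_seq G f n" and m: "0 < m" "m + 2 \<le> n"
    and no: "\<And>i. m + 1 < i \<Longrightarrow> i < n \<Longrightarrow> \<not> adj (f m) (f i)"
  shows "toll_seq G (\<lambda>i. f (m + i)) (n - m)"
proof -
  have "toll_seq G (\<lambda>i. f (n - i)) (n - m)"
  proof (rule toll_seq_take[OF toll_seq_rev[OF f]])
    fix i assume i: "1 \<le> i" "i + 1 < n - m"
    then have "\<not> adj (f m) (f (n - i))" by (intro no) auto
    then show "\<not> adj (f (n - i)) (f (n - (n - m)))" using m adj_sym by simp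
  qed (use m in auto)
  from toll_seq_rev[OF this] have *: "toll_seq G (\<lambda>i. f (n - (n - m - i))) (n - m)" .
  have "f (n - (n - m - i)) = f (m + i)" if "i \<le> n - m" for i
    using that m by (simp add: add.commute)
  then show ?thesis
    using * toll_seq_cong[of "n - m" "\<lambda>i. f (n - (n - m - i))" "\<lambda>i. f (m + i)" G] by simp
qed

text \<open>The chord bypasses the positions strictly between \<open>i\<close> and \<open>j\<close>.
  As \<open>1 \<le> i\<close> and \<open>j \<le> n - 1\<close>, the second and the penultimate
  vertex survive, and with them the conditions at both ends.\<close>

lemma toll_seq_cut:
  assumes f: "toll_seq G f n" and ij: "1 \<le> i" "i < j" "j \<le> n - 1" and adj: "adj (f i) (f j)"
  shows "toll_seq G (\<lambda>t. if t \<le> i then f t else f (t + (j - i - 1))) (n - (j - i - 1))"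
    (is "toll_seq G ?g ?m")
proof -
  note f' = f[unfolded toll_seq_def]
  have m: "?m > i" "?m + (j - i - 1) = n" "?m \<ge> 2" "?g 0 = f 0" "?g ?m = f n"
    using ij by auto
  have "adj (?g t) (?g (Suc t))" if "t < ?m" for t
    using that f' ij m adj by (cases "t < i"; cases "t = i") auto
  moreover have "adj (f 0) (?g t) \<longleftrightarrow> t = 1" if "t \<le> ?m" for t
    using that f' ij m by (cases "t \<le> i") auto
  moreover have "adj (f n) (?g t) \<longleftrightarrow> t = ?m - 1" if t: "t \<le> ?m" for t
  proof (cases "t \<le> i")
    case True
    then have "t \<noteq> n - 1" "t \<le> n" using ij by auto
    moreover have "t \<noteq> ?m - 1" using True ij by auto
    ultimately show ?thesis using f' True by (metis m(5))
  next
    case False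
    then show ?thesis using t f' ij m by auto
  qed
  moreover have "?g t \<in> V" if "t \<le> ?m" for t
    using that f' ij m by (cases "t \<le> i") auto
  ultimately show ?thesis
    using f' m unfolding toll_seq_def by auto
qed

section \<open>From the transit function to toll walks\<close>

text \<open>Induction on \<open>card (R x v)\<close>: (TWA) supplies a neighbour \<open>x1\<close>
  of \<open>x\<close> that is far from \<open>u\<close> and has a smaller set \<open>R x1 v\<close>.
  Position 0 is exempt from the condition on \<open>u\<close>, since \<open>x\<close> itself may be
  adjacent to \<open>u\<close>.\<close>

lemma TWA_imp_walk_avoiding_nbhd:
  assumes TWA: "axiom_TWA V R" and u: "u \<in> V" and v: "v \<in> V"
    and x: "x \<in> R u v" "x \<noteq> u" "x \<noteq> v"
  shows "\<exists>f m. m \<ge> 1 \<and> f 0 = x \<and> f m = v \<and> (\<forall>i\<le>m. f i \<in> V) \<and>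
    (\<forall>i<m. adj (f i) (f (Suc i))) \<and>
    (\<forall>i\<le>m. 0 < i \<longrightarrow> f i \<noteq> u \<and> \<not> adj u (f i)) \<and>
    (\<forall>i\<le>m. adj v (f i) \<longleftrightarrow> i = m - 1)"
  using x
proof (induction "card (R x v)" arbitrary: x rule: less_induct)
  case less
  have xV: "x \<in> V" using less.prems(1) R_subset u v by blast
  have "u \<noteq> v" using less.prems(1,2) R_refl u by auto
  then obtain x1 where x1: "x1 \<in> R x v" "x1 \<in> R u v" "x1 \<noteq> x" "R x x1 = {x, x1}"
    "R u x1 \<noteq> {u, x1}" "R x1 v \<subset> R x v"
    using TWA[unfolded axiom_TWA_def, rule_format, of u v x] u v xV less.prems by blast
  have x1V: "x1 \<in> V" using x1(2) R_subset u v by blast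
  have adj1: "adj x x1" using x1 xV x1V by (simp add: adj_iff)
  have u1: "x1 \<noteq> u" "\<not> adj u x1" using x1(5) R_eq_pair_iff u x1V by auto
  show ?case
  proof (cases "x1 = v")
    case True
    let ?f = "\<lambda>i. if i = 0 then x else v"
    have "adj v x" using adj1 True adj_sym by blast
    then show ?thesis
      by (intro exI[of _ ?f] exI[of _ 1]) (use True adj1 u1 v xV not_adj_self in auto)
  next
    case False
    have "finite (R x v)" using R_subset[OF xV v] finite_V by (rule finite_subset)
    then have "card (R x1 v) < card (R x v)" using x1(6) psubset_card_mono by blast
    from less.hyps[OF this x1(2) u1(1) False] obtain g m where g:
      "m \<ge> 1" "g 0 = x1" "g m = v" "\<forall>i\<le>m. g i \<in> V" "\<forall>i<m. adj (g i) (g (Suc i))"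
      "\<forall>i\<le>m. 0 < i \<longrightarrow> g i \<noteq> u \<and> \<not> adj u (g i)"
      "\<forall>i\<le>m. adj v (g i) \<longleftrightarrow> i = m - 1"
      by (elim exE conjE)
    let ?f = "\<lambda>i. case i of 0 \<Rightarrow> x | Suc j \<Rightarrow> g j"
    \<comment> \<open>Adjacency would give \<open>R x v = {x, v}\<close> and so force
      \<open>x1 = v\<close>. This keeps the penultimate vertex the only neighbour of
      \<open>v\<close>.\<close>
    have "\<not> adj v x"
    proof
      assume "adj v x"
      then have "R x v = {x, v}" using adj_sym[of v x] adj_iff[of x v] by blast
      moreover have "x1 \<in> R x1 v" "v \<in> R x1 v" using R_left R_right x1V v by auto
      ultimately show False using x1 False by blast
    qed
    \<comment> \<open>For position 0, which the induction hypothesis exempts, the choice of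
      \<open>x1\<close> steps in.\<close>
    have "g i \<noteq> u \<and> \<not> adj u (g i)" if "i \<le> m" for i
      using that g(2,6) u1 by (cases "i = 0") auto
    then have "\<forall>i\<le>Suc m. 0 < i \<longrightarrow> ?f i \<noteq> u \<and> \<not> adj u (?f i)"
      by (auto split: nat.split)
    moreover have "\<forall>i\<le>Suc m. adj v (?f i) \<longleftrightarrow> i = Suc m - 1"
      using \<open>\<not> adj v x\<close> g(1,7) by (auto split: nat.split)
    moreover have "\<forall>i\<le>Suc m. ?f i \<in> V"
      using xV g(4) by (auto split: nat.split)
    moreover have "\<forall>i<Suc m. adj (?f i) (?f (Suc i))"
      using adj1 g(2,5) by (auto split: nat.split)
    ultimately show ?thesis
      using g(3) by (intro exI[of _ ?f] exI[of _ "Suc m"] conjI) (assumption | simp)+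
  qed
qed

lemma inner_in_toll_transit:
  assumes TWA: "axiom_TWA V R" and u: "u \<in> V" and v: "v \<in> V"
    and x: "x \<in> R u v" "x \<noteq> u" "x \<noteq> v"
  shows "{u, x, v} \<subseteq> toll_transit G u v"
proof -
  from TWA_imp_walk_avoiding_nbhd[OF TWA u v x] obtain f m where f:
    "m \<ge> 1" "f 0 = x" "f m = v" "\<forall>i\<le>m. f i \<in> V" "\<forall>i<m. adj (f i) (f (Suc i))"
    "\<forall>i\<le>m. 0 < i \<longrightarrow> f i \<noteq> u \<and> \<not> adj u (f i)"
    "\<forall>i\<le>m. adj v (f i) \<longleftrightarrow> i = m - 1"
    by (elim exE conjE)
  have "x \<in> R v u" using x R_sym u v by blast
  from TWA_imp_walk_avoiding_nbhd[OF TWA v u this x(3,2)] obtain g l where g: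
    "l \<ge> 1" "g 0 = x" "g l = u" "\<forall>i\<le>l. g i \<in> V" "\<forall>i<l. adj (g i) (g (Suc i))"
    "\<forall>i\<le>l. 0 < i \<longrightarrow> g i \<noteq> v \<and> \<not> adj v (g i)"
    "\<forall>i\<le>l. adj u (g i) \<longleftrightarrow> i = l - 1"
    by (elim exE conjE)
  \<comment> \<open>\<open>?h\<close> follows \<open>g\<close> backwards from \<open>u\<close> to
    \<open>x\<close>, at position \<open>l\<close>, and then \<open>f\<close> to \<open>v\<close>.
    Beyond \<open>x\<close> each of the two walks avoids the far end of the other and its
    neighbours; at \<open>x\<close> itself, \<open>g\<close> controls adjacency to \<open>u\<close>
    and \<open>f\<close> adjacency to \<open>v\<close>.\<close>
  let ?h = "\<lambda>i. if i \<le> l then g (l - i) else f (i - l)"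
  have "adj (?h i) (?h (Suc i))" if "i < l + m" for i
  proof -
    have "i < l \<or> i = l \<or> l < i" by arith
    then show ?thesis
    proof (elim disjE)
      assume "i < l"
      then show ?thesis using g(5)[rule_format, of "l - Suc i"] adj_sym by (simp add: Suc_diff_Suc)
    next
      assume "i = l"
      then show ?thesis using f(1,2) f(5)[rule_format, of 0] g(2) by simp
    next
      assume "l < i"
      then show ?thesis using f(5)[rule_format, of "i - l"] that by (simp add: Suc_diff_le)
    qed
  qed
  moreover have "adj u (?h i) \<longleftrightarrow> i = 1" if "i \<le> l + m" for i
    using that g(1) g(7)[rule_format, of "l - i"] f(6)[rule_format, of "i - l"] by auto
  moreover have "adj v (?h i) \<longleftrightarrow> i = l + m - 1" if "i \<le> l + m" for i
  proof -
    have "i < l \<or> i = l \<or> l < i" by arith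
    then show ?thesis
      using that f(1) g(6)[rule_format, of "l - i"] f(7)[rule_format, of "i - l"] g(2) f(2) by auto
  qed
  moreover have "?h i \<in> V" if "i \<le> l + m" for i
    using that f(4) g(4) by auto
  moreover have ends: "?h 0 = u" "?h (l + m) = v"
    using f(1-3) g(1-3) by auto
  moreover have "u \<noteq> v" using x R_refl u by auto
  ultimately have "toll_seq G ?h (l + m)"
    using f(1) unfolding toll_seq_def by simp
  then have "?h i \<in> toll_transit G u v" if "i \<le> l + m" for i
    unfolding toll_transit_eq_toll_seq[OF \<open>u \<noteq> v\<close>] using ends that
    by (intro CollectI exI[of _ ?h] exI[of _ i] exI[of _ "l + m"]) simp
  from this[of 0] this[of l] this[of "l + m"] show ?thesis
    using ends g(2) by simp
qed

text \<open>The endpoints need a toll walk as well: if \<open>R u v\<close> has a further vertex,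
  the walk through it covers them, and otherwise the edge from \<open>u\<close> to \<open>v\<close>
  does.\<close>

lemma R_subset_toll_transit:
  assumes TWA: "axiom_TWA V R" and u: "u \<in> V" and v: "v \<in> V" and uv: "u \<noteq> v"
  shows "R u v \<subseteq> toll_transit G u v"
proof (cases "R u v = {u, v}")
  case True
  then have "adj u v" "adj v u" using u v uv adj_sym by (auto simp: adj_iff)
  then have "toll_walk G [u, v]"
    using u v uv not_adj_self by (auto simp: toll_walk_def vwalk_def less_Suc_eq)
  then have "{u, v} \<subseteq> toll_transit G u v"
    using uv by (auto simp: toll_transit_def intro!: exI[of _ "[u, v]"])
  then show ?thesis using True by simp
next
  case False
  have "u \<in> R u v" "v \<in> R u v" using R_left R_right u v by auto
  with False obtain y where "y \<in> R u v" "y \<noteq> u" "y \<noteq> v" by blast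
  then show ?thesis using inner_in_toll_transit[OF TWA u v] by blast
qed

section \<open>From toll walks to the transit function\<close>

text \<open>The induction on \<open>n\<close> ranges over all \<open>f\<close>, because the shorter
  walks that arise may have other endpoints.\<close>

lemma toll_seq_in_R:
  assumes J2: "axiom_J2 V R" and J4: "axiom_J4 V R" and J4': "axiom_J4' V R"
    and TW1': "axiom_TW1' V R"
  shows "toll_seq G f n \<Longrightarrow> i \<le> n \<Longrightarrow> f i \<in> R (f 0) (f n)"
proof (induction n arbitrary: f i rule: less_induct)
  case (less n)
  note f = less.prems(1)
  let ?u = "f 0" and ?v = "f n"
  let ?S = "R ?u ?v"
  have V: "f i \<in> V" if "i \<le> n" for i using that f by (simp add: toll_seq_def)
  have step: "adj (f i) (f (Suc i))" "adj (f (Suc i)) (f i)" if "i < n" for i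
    using that f adj_sym by (auto simp: toll_seq_def)
  have adj_R: "R x y = {x, y}" if "adj x y" for x y using that by (simp add: adj_iff)
  have n: "n \<ge> 1" using f by (simp add: toll_seq_def)
  have uv: "?u \<noteq> ?v" using f by (simp add: toll_seq_def)
  have u_far: "R ?u (f i) \<noteq> {?u, f i}" if "2 \<le> i" "i \<le> n" for i
    using that f toll_seq_first_neq[OF f, of i] V by (auto simp: toll_seq_def R_eq_pair_iff)
  have v_far: "R (f i) ?v \<noteq> {f i, ?v}" if "i + 2 \<le> n" for i
    using that f toll_seq_last_neq[OF f, of i] V adj_sym[of "f i" ?v]
    by (auto simp: toll_seq_def R_eq_pair_iff)
  have inS: "f 0 \<in> ?S" "f n \<in> ?S" using V R_left R_right by auto
  have J2': "f (Suc i) \<in> R (f i) (f (i + 2))"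
    if "i + 2 \<le> n" "f i \<noteq> f (i + 2)" "R (f i) (f (i + 2)) \<noteq> {f i, f (i + 2)}" for i
    using J2[unfolded axiom_J2_def, rule_format, of "f i" "f (i + 2)" "f (Suc i)"]
      that V adj_R step[of i] step[of "Suc i"] by simp
  \<comment> \<open>(J4) is applied once from each end, with \<open>?u\<close> and \<open>?v\<close>
    exchanged the second time.\<close>
  have ends: "f 1 \<in> ?S \<and> f (n - 1) \<in> ?S"
    if "n \<ge> 3" "f 1 \<in> R ?u (f (n - 1))" "f (n - 1) \<in> R (f 1) ?v" "f 1 \<noteq> f (n - 1)"
  proof -
    have st: "adj ?u (f 1)" "adj (f (n - 1)) ?v" "adj ?v (f (n - 1))" "adj (f 1) ?u"
      using step[of 0] step[of "n - 1"] that(1) by auto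
    have nn: "f 1 \<in> V" "f (n - 1) \<in> V" "?u \<in> V" "?v \<in> V" using V that(1) by auto
    have far: "R ?u ?v \<noteq> {?u, ?v}" using u_far[of n] that(1) by auto
    have "f 1 \<in> ?S"
      using J4[unfolded axiom_J4_def, rule_format, of ?u ?v "f 1" "f (n - 1)"]
        that nn st adj_R far by blast
    moreover have "f (n - 1) \<in> R ?v ?u"
      using J4[unfolded axiom_J4_def, rule_format, of ?v ?u "f (n - 1)" "f 1"]
        that nn far R_sym[of ?v ?u] R_sym[of ?v "f 1"] R_sym[of "f (n - 1)" ?u]
        adj_R[OF st(3)] adj_R[OF st(4)] by (simp add: insert_commute)
    ultimately show ?thesis using R_sym nn by blast
  qed
  \<comment> \<open>(TW1') is used degenerately, with \<open>x = y = w = f i\<close> and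
    \<open>z = f j\<close>; its condition on \<open>R w y\<close> then holds by reflexivity.\<close>
  have propagate: "f j \<in> ?S"
    if i: "2 \<le> i" "i + 2 \<le> n" "f i \<in> ?S" and ij: "j = Suc i \<or> i = Suc j" for i j
  proof -
    have "adj (f i) (f j)" "adj (f j) (f i)" using step[of i] step[of j] i ij by auto
    moreover have "j \<le> n" using i ij by auto
    moreover have "f i \<noteq> ?u" "f i \<noteq> ?v"
      using toll_seq_first_neq[OF f, of i] toll_seq_last_neq[OF f, of i] i by auto
    moreover have "R (f i) (f i) = {f i, f i}" using R_refl V i by auto
    ultimately show ?thesis
      using TW1'[unfolded axiom_TW1'_def, rule_format, of ?u ?v "f i" "f i" "f j" "f i"]
        V u_far[of i] v_far[of i] i adj_R by simp
  qed
  have suffices: "f j \<in> ?S" if i: "2 \<le> i" "i + 2 \<le> n" "f i \<in> ?S" and j: "j \<le> n" for i j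
  proof -
    have up: "f (i + k) \<in> ?S" if "i + k + 1 \<le> n" for k
      using that
    proof (induction k)
      case (Suc k)
      have "f (i + k) \<in> ?S" using Suc by simp
      moreover have "2 \<le> i + k" "i + k + 2 \<le> n" "i + Suc k = Suc (i + k)" using Suc.prems i by auto
      ultimately show ?case using propagate by blast
    qed (use i in auto)
    have down: "f (i - k) \<in> ?S" if "k + 1 \<le> i" for k
      using that
    proof (induction k)
      case (Suc k)
      have "f (i - k) \<in> ?S" using Suc by simp
      moreover have "2 \<le> i - k" "i - k + 2 \<le> n" "i - k = Suc (i - Suc k)" using Suc.prems i by auto
      ultimately show ?case using propagate by blast
    qed (use i in auto)
    have "j = 0 \<or> j = n \<or> i \<le> j \<and> j + 1 \<le> n \<or> 1 \<le> j \<and> j \<le> i" using j by arith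
    then show ?thesis
      using inS up[of "j - i"] down[of "i - j"] by auto
  qed
  have "n = 1 \<or> n = 2 \<or> n = 3 \<or> n \<ge> 4" using n by arith
  \<comment> \<open>Cutting along the pair \<open>(1, n - 1)\<close> would leave a walk with three
    edges, without any vertex at distance at least two from both ends in the walk, so
    \<open>suffices\<close> could not be applied to it.\<close>
  then consider "n = 1" | "n = 2" | "n = 3"
    | i j where "n \<ge> 4" "1 \<le> i" "i + 1 < j" "j \<le> n - 1" "(i, j) \<noteq> (1, n - 1)" "adj (f i) (f j)"
    | "n \<ge> 4"
      "\<And>i j. 1 \<le> i \<Longrightarrow> i + 1 < j \<Longrightarrow> j \<le> n - 1 \<Longrightarrow> (i, j) \<noteq> (1, n - 1) \<Longrightarrow> \<not> adj (f i) (f j)"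
    by blast
  then show ?case
  proof cases
    case 1
    then have "i = 0 \<or> i = n" using less.prems(2) by auto
    then show ?thesis using inS by auto
  next
    case 2
    then have "i = 0 \<or> i = n \<or> i = 1" using less.prems(2) by auto
    then show ?thesis using inS J2'[of 0] uv u_far[of n] 2 by (auto simp: numeral_2_eq_2)
  next
    case 3
    \<comment> \<open>(J2) at each half of the walk provides the premises of (J4).\<close>
    have "f 1 \<in> R ?u (f 2)"
      using J2'[of 0] u_far[of 2] toll_seq_first_neq[OF f, of 2] 3 by (auto simp: numeral_2_eq_2)
    moreover have "f 2 \<in> R (f 1) ?v"
      using J2'[of 1] v_far[of 1] toll_seq_last_neq[OF f, of 1] 3
      by (auto simp: numeral_2_eq_2 numeral_3_eq_3)
    moreover have "f 1 \<noteq> f 2" using step[of 1] 3 not_adj_self by (auto simp: numeral_2_eq_2)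
    ultimately have "f 1 \<in> ?S" "f 2 \<in> ?S" using ends 3 by auto
    moreover have "i = 0 \<or> i = n \<or> i = 1 \<or> i = 2" using less.prems(2) 3 by auto
    ultimately show ?thesis using inS by auto
  next
    case (4 k l)
    let ?g = "\<lambda>t. if t \<le> k then f t else f (t + (l - k - 1))"
    let ?m = "n - (l - k - 1)"
    have "toll_seq G ?g ?m" using toll_seq_cut[OF f, of k l] 4 by auto
    moreover have "?m < n" "2 \<le> ?m" "\<not> ?m \<le> k" "?m + (l - k - 1) = n" using 4 by auto
    \<comment> \<open>Position 2 of the shortened walk is \<open>f 2\<close> if
      \<open>k \<ge> 2\<close> and \<open>f l\<close> if \<open>k = 1\<close>. Both are positions of
      \<open>f\<close> in \<open>2..n-2\<close>, the latter because the pair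
      \<open>(1, n - 1)\<close> is excluded.\<close>
    ultimately have *: "?g 2 \<in> ?S" using less.IH[of ?m ?g 2] by auto
    show ?thesis
    proof (cases "2 \<le> k")
      case True
      then show ?thesis using suffices[of 2 i] * 4 less.prems(2) by auto
    next
      case False
      then have "k = 1" "l + 2 \<le> n" "2 \<le> l" "2 + (l - k - 1) = l" using 4 by auto
      then show ?thesis using suffices[of l i] * less.prems(2) by auto
    qed
  next
    case 5
    note no = 5(2)
    have "\<exists>k. 2 \<le> k \<and> k + 2 \<le> n \<and> f k \<in> ?S"
    proof (cases "n \<le> 5")
      case True
      have nb: "n - 1 \<le> n" "Suc (n - 1) = n" "n - 1 < n" using 5 by auto
      have neq: "f 1 \<noteq> f (n - 1)" using v_far[of 1] adj_R step[of "n - 1"] nb 5(1) by auto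
      have a: "f 1 \<in> R ?u (f (n - 1))" and b: "f (n - 1) \<in> R (f 1) ?v"
      proof -
        have st: "adj ?u (f 1)" "adj (f (n - 1)) ?v" using step[of 0] step[of "n - 1"] nb 5 by auto
        have nV: "f 1 \<in> V" "f (n - 1) \<in> V" "?u \<in> V" "?v \<in> V" using V nb by auto
        have "f 1 \<in> R ?u (f (n - 1)) \<and> f (n - 1) \<in> R (f 1) ?v"
        \<comment> \<open>If the remaining chord is present, (J2) applies to both triangles' missing
          sides: \<open>f 1\<close> lies between \<open>?u\<close> and \<open>f (n - 1)\<close>, and
          \<open>f (n - 1)\<close> between \<open>f 1\<close> and \<open>?v\<close>. If it is
          absent, dropping either end vertex leaves a toll walk.\<close>
        proof (cases "adj (f 1) (f (n - 1))")
          case True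
          have "?u \<noteq> f (n - 1)" "f 1 \<noteq> ?v"
            using toll_seq_first_neq[OF f, of "n - 1"] toll_seq_last_neq[OF f, of 1] 5(1) by auto
          moreover have "R ?u (f (n - 1)) \<noteq> {?u, f (n - 1)}" "R (f 1) ?v \<noteq> {f 1, ?v}"
            using u_far[of "n - 1"] v_far[of 1] 5(1) by simp_all
          ultimately show ?thesis
            using J2[unfolded axiom_J2_def, rule_format, of ?u "f (n - 1)" "f 1"]
              J2[unfolded axiom_J2_def, rule_format, of "f 1" ?v "f (n - 1)"]
              nV st[THEN adj_R] adj_R[OF True] by blast
        next
          case False
          have chordless: "\<not> adj (f i) (f j)" if "1 \<le> i" "i + 1 < j" "j \<le> n - 1" for i j
            using no[OF that] False by blast
          have "toll_seq G f (n - 1)"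
            by (rule toll_seq_take[OF f _ _ chordless]) (use 5(1) in simp_all)
          then have "f 1 \<in> R ?u (f (n - 1))"
            using less.IH[of "n - 1" f 1] 5(1) by simp
          moreover have "toll_seq G (\<lambda>i. f (1 + i)) (n - 1)"
            by (rule toll_seq_drop[OF f _ _ chordless]) (use 5(1) in simp_all)
          then have "f (1 + (n - 2)) \<in> R (f (1 + 0)) (f (1 + (n - 1)))"
            using less.IH[of "n - 1" "\<lambda>i. f (1 + i)" "n - 2"] 5(1) by simp
          moreover have "1 + (n - 2) = n - 1" "1 + (n - 1) = n" using 5(1) by simp_all
          ultimately show ?thesis by simp
        qed
        then show "f 1 \<in> R ?u (f (n - 1))" "f (n - 1) \<in> R (f 1) ?v" by auto
      qed
      have ab: "f 1 \<in> ?S" "f (n - 1) \<in> ?S" using ends a b neq 5(1) by auto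
      \<comment> \<open>Here \<open>n \<le> 5\<close> matters: \<open>f 2\<close> and
        \<open>f (n - 2)\<close> coincide for \<open>n = 4\<close> and are adjacent for
        \<open>n = 5\<close>, as (TW1') requires of \<open>z\<close> and \<open>w\<close>.\<close>
      have "R (f 2) (f (n - 2)) = {f 2, f (n - 2)}"
      proof -
        have "n - 2 = 2 \<or> n - 2 = Suc 2" using True 5(1) by auto
        then show ?thesis using adj_R step(1)[of 2] True 5(1) R_refl[OF V[of 2]] by auto
      qed
      moreover have "adj (f 1) (f 2)" "adj (f (n - 2)) (f (n - 1))"
        using step(1)[of 1] step(1)[of "n - 2"] 5(1) by (auto simp: numeral_2_eq_2 Suc_diff_Suc)
      then have "R (f 1) (f 2) = {f 1, f 2}" "R (f (n - 2)) (f (n - 1)) = {f (n - 2), f (n - 1)}"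
        using adj_R by blast+
      moreover have "f 1 \<noteq> ?u" "f (n - 1) \<noteq> ?v"
        using toll_seq_first_neq[OF f, of 1] toll_seq_last_neq[OF f, of "n - 1"] 5(1) by auto
      moreover have "R (f 1) ?v \<noteq> {f 1, ?v}" "R ?u (f (n - 1)) \<noteq> {?u, f (n - 1)}"
        "R ?u (f (n - 2)) \<noteq> {?u, f (n - 2)}"
        using v_far[of 1] u_far[of "n - 1"] u_far[of "n - 2"] 5(1) by simp_all
      moreover have "?u \<in> V" "?v \<in> V" "f 1 \<in> V" "f (n - 1) \<in> V" "f 2 \<in> V" "f (n - 2) \<in> V"
        using V 5(1) by simp_all
      ultimately have "f 2 \<in> ?S"
        using TW1'[unfolded axiom_TW1'_def, rule_format,
            of ?u ?v "f 1" "f (n - 1)" "f 2" "f (n - 2)"] ab by blast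
      then show ?thesis using 5(1) by auto
    next
      case False
      \<comment> \<open>Truncating at \<open>n - 2\<close> and dropping up to 2 never involve the
        pair \<open>(1, n - 1)\<close>, so \<open>no\<close> is enough.\<close>
      have "toll_seq G f (n - 2)"
        by (rule toll_seq_take[OF f _ _ no]) (use False in auto)
      then have a: "f 2 \<in> R ?u (f (n - 2))" using less.IH[of "n - 2" f 2] False by simp
      have "toll_seq G (\<lambda>i. f (2 + i)) (n - 2)"
        by (rule toll_seq_drop[OF f _ _ no]) (use False in auto)
      then have "f (2 + (n - 4)) \<in> R (f (2 + 0)) (f (2 + (n - 2)))"
        using less.IH[of "n - 2" "\<lambda>i. f (2 + i)" "n - 4"] False by simp
      moreover have "2 + (n - 4) = n - 2" "2 + (n - 2) = n" using False by simp_all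
      ultimately have b: "f (n - 2) \<in> R (f 2) ?v" by simp
      \<comment> \<open>Vertices may repeat on the walk, so \<open>f 2\<close> and
        \<open>f (n - 2)\<close> have to be told apart, here by their adjacency to
        \<open>f (n - 1)\<close>.\<close>
      have "adj (f (n - 2)) (f (n - 1))"
        using step(1)[of "n - 2"] False by (auto simp: numeral_2_eq_2 Suc_diff_Suc)
      moreover have "\<not> adj (f 2) (f (n - 1))" using no[of 2 "n - 1"] False by simp
      ultimately have "f 2 \<noteq> f (n - 2)" by metis
      then have "R (f 2) (f (n - 2)) \<noteq> {f 2, f (n - 2)}"
        using no[of 2 "n - 2"] False V by (auto simp: R_eq_pair_iff)
      moreover have "R ?u (f 2) \<noteq> {?u, f 2}" "R (f (n - 2)) ?v \<noteq> {f (n - 2), ?v}"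
        "R ?u ?v \<noteq> {?u, ?v}"
        using u_far[of 2] v_far[of "n - 2"] u_far[of n] False by simp_all
      moreover have "?u \<in> V" "?v \<in> V" "f 2 \<in> V" "f (n - 2) \<in> V"
        using V False by simp_all
      ultimately have "f 2 \<in> ?S"
        using J4'[unfolded axiom_J4'_def, rule_format, of ?u ?v "f 2" "f (n - 2)"] a b by blast
      then show ?thesis using False by auto
    qed
    then show ?thesis using suffices less.prems(2) by blast
  qed
qed

end

theorem theorem9:
  fixes V :: "'a set" and R :: "'a \<Rightarrow> 'a \<Rightarrow> 'a set"
  assumes "finite V" and "V \<noteq> {}"
    and "transit_function V R"
    and "axiom_b1' V R" and "axiom_b2' V R"
    and "axiom_J2 V R" and "axiom_J4 V R" and "axiom_J4' V R"
    and "axiom_TW1' V R" and "axiom_TWA V R"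
  shows "\<forall>u\<in>V. \<forall>v\<in>V. R u v = toll_transit (underlying_graph V R) u v"
proof (intro ballI)
  interpret transit V R by unfold_locales fact+
  fix u v assume uv: "u \<in> V" "v \<in> V"
  show "R u v = toll_transit G u v"
  proof (cases "u = v")
    case True
    then show ?thesis using uv R_refl by (simp add: toll_transit_def)
  next
    case False
    show ?thesis
    proof
      show "R u v \<subseteq> toll_transit G u v"
        using R_subset_toll_transit assms(10) uv False by blast
      show "toll_transit G u v \<subseteq> R u v"
        using toll_seq_in_R[OF assms(6-9)] unfolding toll_transit_eq_toll_seq[OF False] by blast
    qed
  qed
qed

end
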